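(* Let $(X,d)$ be an infinite metric space and let $\mathfrak{B}$ be a bornology on $X$ with a closed base such that $X\notin\mathfrak{B}$. Then the supertightness and the tightness of $(C(X),\tau^s_{\mathfrak{B}})$ coincide: $st(C(X),\tau^s_{\mathfrak{B}})=t(C(X),\tau^s_{\mathfrak{B}})$.
   Context: A bornology on a set $X$ is a family $\mathfrak{B}$ of subsets of $X$ that covers $X$, is closed under finite unions and is closed under taking subsets. A base of $\mathfrak{B}$ is a subfamily $\mathfrak{B}_0\subseteq\mathfrak{B}$ such that every $B\in\mathfrak{B}$ is contained in some $B_0\in\mathfrak{B}_0$; it is a closed base if all its members are closed in $X$. For $B\subseteq X$ and $\delta>0$, $B^\delta=\bigcup_{x\in B}\{y\in X: d(x,y)<\delta\}$. $C(X)$ is the set of continuous functions $X\to\mathbb{R}$. The topology $\tau^s_{\mathfrak{B}}$ of strong uniform convergence on $\mathfrak{B}$ is the topology on $C(X)$ induced by the uniformity with base consisting of the sets $[B,\varepsilon]^s=\{(f,g): \exists\delta>0\ \forall x\in B^\delta,\ |f(x)-g(x)|<\varepsilon\}$, $B\in\mathfrak{B}$, $\varepsilon>0$. For a topological space $Y$: the tightness $t(Y)$ is the smallest infinite cardinal $\mathfrak{m}$ such that whenever $A\subseteq Y$ and $y\in\overline{A}$ there is $B\subseteq A$ with $|B|\le\mathfrak{m}$ and $y\in\overline{B}$. A family $\mathcal{A}$ of subsets of $Y$ is a $\pi$-network at $y\in Y$ if every neighbourhood of $y$ contains a member of $\mathcal{A}$. $st(y,Y)$ is the smallest cardinal $\mathfrak{m}$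 such that every $\pi$-network at $y$ consisting of finite subsets of $Y$ has a subfamily of cardinality at most $\mathfrak{m}$ which is a $\pi$-network at $y$. The supertightness is $st(Y)=\omega\cdot\sup\{st(y,Y):y\in Y\}$. *)

theory Defs
  imports "HOL-Analysis.Analysis"
begin

(* Set_Algebras uses the same symbol as cardinal equality *)
no_notation Set_Algebras.elt_set_eq (infix "=o" 50)
unbundle cardinal_syntax

section \<open>Bornologies\<close>

definition bornology :: "'a set set \<Rightarrow> bool" where
  "bornology \<BB> \<longleftrightarrow>
     \<Union>\<BB> = UNIV \<and>
     (\<forall>A\<in>\<BB>. \<forall>B\<in>\<BB>. A \<union> B \<in> \<BB>) \<and>
     (\<forall>B\<in>\<BB>. \<forall>A. A \<subseteq> B \<longrightarrow> A \<in> \<BB>)"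

definition bornology_base :: "'a set set \<Rightarrow> 'a set set \<Rightarrow> bool" where
  "bornology_base \<BB> \<BB>\<^sub>0 \<longleftrightarrow> \<BB>\<^sub>0 \<subseteq> \<BB> \<and> (\<forall>B\<in>\<BB>. \<exists>B\<^sub>0\<in>\<BB>\<^sub>0. B \<subseteq> B\<^sub>0)"

definition has_closed_base :: "'a::topological_space set set \<Rightarrow> bool" where
  "has_closed_base \<BB> \<longleftrightarrow> (\<exists>\<BB>\<^sub>0. bornology_base \<BB> \<BB>\<^sub>0 \<and> (\<forall>B\<in>\<BB>\<^sub>0. closed B))"


section \<open>The topology of strong uniform convergence\<close>

definition enlargement :: "'a::metric_space set \<Rightarrow> real \<Rightarrow> 'a set" where
  "enlargement B \<delta> = (\<Union>x\<in>B. ball x \<delta>)"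

definition cont_funs :: "('a::topological_space \<Rightarrow> real) set" where
  "cont_funs = {f. continuous_on UNIV f}"

definition strong_entourage ::
    "'a::metric_space set \<Rightarrow> real \<Rightarrow> (('a \<Rightarrow> real) \<times> ('a \<Rightarrow> real)) set" where
  "strong_entourage B \<epsilon> =
     {(f, g). f \<in> cont_funs \<and> g \<in> cont_funs \<and>
        (\<exists>\<delta>>0. \<forall>x\<in>enlargement B \<delta>. \<bar>f x - g x\<bar> < \<epsilon>)}"

definition strong_entourages ::
    "'a::metric_space set set \<Rightarrow> (('a \<Rightarrow> real) \<times> ('a \<Rightarrow> real)) set set" where
  "strong_entourages \<BB> = {strong_entourage B \<epsilon> | B \<epsilon>. B \<in> \<BB> \<and> \<epsilon> > 0}"

text \<open>The topology on \<open>S\<close> induced by the uniformity with base \<open>\<E>\<close>: a set is open iff with each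
  of its points \<open>f\<close> it contains the section \<open>V `` {f}\<close> of some entourage \<open>V\<close>.\<close>

definition uniformity_base_topology :: "'b set \<Rightarrow> ('b \<times> 'b) set set \<Rightarrow> 'b topology" where
  "uniformity_base_topology S \<E> =
     topology (\<lambda>U. U \<subseteq> S \<and> (\<forall>f\<in>U. \<exists>V\<in>\<E>. V `` {f} \<subseteq> U))"

definition strong_uniform_topology :: "'a::metric_space set set \<Rightarrow> ('a \<Rightarrow> real) topology" where
  "strong_uniform_topology \<BB> = uniformity_base_topology cont_funs (strong_entourages \<BB>)"

lemma enlargement_mono: "B \<subseteq> C \<Longrightarrow> \<delta> \<le> \<eta> \<Longrightarrow> enlargement B \<delta> \<subseteq> enlargement C \<eta>"
  by (force simp: enlargement_def)

lemma strong_entourage_mono: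
  assumes "B \<subseteq> C" "\<epsilon> \<le> \<eta>"
  shows "strong_entourage C \<epsilon> \<subseteq> strong_entourage B \<eta>"
  using enlargement_mono[OF assms(1) order_refl] assms(2)
  unfolding strong_entourage_def by (clarsimp; meson less_le_trans subsetD)

lemma strong_entourages_directed:
  assumes "bornology \<BB>" "V \<in> strong_entourages \<BB>" "W \<in> strong_entourages \<BB>"
  shows "\<exists>Z\<in>strong_entourages \<BB>. Z \<subseteq> V \<inter> W"
proof -
  obtain B \<epsilon> C \<eta> where V: "V = strong_entourage B \<epsilon>" "B \<in> \<BB>" "\<epsilon> > 0"
    and W: "W = strong_entourage C \<eta>" "C \<in> \<BB>" "\<eta> > 0"
    using assms(2,3) by (auto simp: strong_entourages_def)
  have "B \<union> C \<in> \<BB>" using assms(1) V W by (auto simp: bornology_def)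
  then have "strong_entourage (B \<union> C) (min \<epsilon> \<eta>) \<in> strong_entourages \<BB>"
    using V(3) W(3) min_less_iff_conj unfolding strong_entourages_def by blast
  moreover have "strong_entourage (B \<union> C) (min \<epsilon> \<eta>) \<subseteq> V \<inter> W"
    unfolding V(1) W(1) by (simp add: strong_entourage_mono)
  ultimately show ?thesis by blast
qed

lemma strong_entourages_nonempty: "bornology \<BB> \<Longrightarrow> strong_entourages \<BB> \<noteq> {}"
proof -
  assume "bornology \<BB>"
  then have "undefined \<in> \<Union>\<BB>" by (simp add: bornology_def)
  then obtain B where "B \<in> \<BB>" by (elim UnionE)
  then have "strong_entourage B 1 \<in> strong_entourages \<BB>"
    unfolding strong_entourages_def mem_Collect_eq by (intro exI[of _ B] exI[of _ 1]) simp
  then show ?thesis by blast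
qed

lemma openin_strong_uniform_topology:
  assumes "bornology \<BB>"
  shows "openin (strong_uniform_topology \<BB>) U \<longleftrightarrow>
           U \<subseteq> cont_funs \<and> (\<forall>f\<in>U. \<exists>V\<in>strong_entourages \<BB>. V `` {f} \<subseteq> U)"
proof -
  let ?P = "\<lambda>U. U \<subseteq> cont_funs \<and> (\<forall>f\<in>U. \<exists>V\<in>strong_entourages \<BB>. V `` {f} \<subseteq> U)"
  have "?P (S \<inter> T)" if S: "?P S" and T: "?P T" for S T
  proof (intro conjI ballI)
    fix f assume "f \<in> S \<inter> T"
    then obtain V W where V: "V \<in> strong_entourages \<BB>" "V `` {f} \<subseteq> S"
      and W: "W \<in> strong_entourages \<BB>" "W `` {f} \<subseteq> T" using S T by blast
    then obtain Z where "Z \<in> strong_entourages \<BB>" "Z \<subseteq> V \<inter> W"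
      using strong_entourages_directed[OF assms] by meson
    moreover from this(2) have "Z `` {f} \<subseteq> S \<inter> T" using V(2) W(2) by fast
    ultimately show "\<exists>V\<in>strong_entourages \<BB>. V `` {f} \<subseteq> S \<inter> T" by blast
  qed (use S in blast)
  moreover have "?P (\<Union>\<K>)" if K: "\<forall>K\<in>\<K>. ?P K" for \<K>
  proof (intro conjI ballI)
    show "\<Union>\<K> \<subseteq> cont_funs" using K by blast
    fix f assume "f \<in> \<Union>\<K>"
    then obtain K where "K \<in> \<K>" "f \<in> K" by blast
    then obtain V where "V \<in> strong_entourages \<BB>" "V `` {f} \<subseteq> K" using K by meson
    then show "\<exists>V\<in>strong_entourages \<BB>. V `` {f} \<subseteq> \<Union>\<K>"
      using \<open>K \<in> \<K>\<close> by (meson Sup_upper subset_trans)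
  qed
  ultimately have "istopology ?P"
    unfolding istopology_def by presburger
  then show ?thesis
    by (simp add: strong_uniform_topology_def uniformity_base_topology_def)
qed

lemma topspace_strong_uniform_topology:
  assumes "bornology \<BB>"
  shows "topspace (strong_uniform_topology \<BB>) = cont_funs"
proof -
  have "openin (strong_uniform_topology \<BB>) cont_funs"
    using strong_entourages_nonempty[OF assms]
    by (auto simp: openin_strong_uniform_topology[OF assms] strong_entourages_def
        strong_entourage_def)
  then show ?thesis
    using openin_strong_uniform_topology[OF assms, of "topspace (strong_uniform_topology \<BB>)"]
    by (simp add: openin_subset subset_antisym)
qed

lemma strong_entourage_neighbourhood:
  assumes "bornology \<BB>" "B \<in> \<BB>" "\<epsilon> > 0" "f \<in> cont_funs"
  shows "\<exists>U. openin (strong_uniform_topology \<BB>) U \<and> f \<in> U \<and> U \<subseteq> strong_entourage B \<epsilon> `` {f}"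
proof (intro exI conjI)
  let ?U = "{g. \<exists>r>0. r < \<epsilon> \<and> (f, g) \<in> strong_entourage B r}"
  show "f \<in> ?U"
  proof -
    have "(f, f) \<in> strong_entourage B (\<epsilon> / 2)"
      using assms by (auto simp: strong_entourage_def intro: zero_less_one)
    then show ?thesis using assms(3) by (auto intro!: exI[of _ "\<epsilon> / 2"])
  qed
  show "?U \<subseteq> strong_entourage B \<epsilon> `` {f}"
    using strong_entourage_mono[OF order_refl less_imp_le] by blast
  show "openin (strong_uniform_topology \<BB>) ?U"
    unfolding openin_strong_uniform_topology[OF assms(1)]
  proof (intro conjI ballI)
    show "?U \<subseteq> cont_funs" by (auto simp: strong_entourage_def)
    fix g assume "g \<in> ?U"
    then obtain r where r: "r > 0" "r < \<epsilon>" "(f, g) \<in> strong_entourage B r" by blast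
    define s where "s = (\<epsilon> - r) / 2"
    have s: "s > 0" "r + s < \<epsilon>" using r by (auto simp: s_def field_simps)
    have "(f, h) \<in> strong_entourage B (r + s)" if h: "(g, h) \<in> strong_entourage B s" for h
    proof -
      obtain d e where de: "d > 0" "e > 0" "\<forall>x\<in>enlargement B d. \<bar>f x - g x\<bar> < r"
          "\<forall>x\<in>enlargement B e. \<bar>g x - h x\<bar> < s"
        using r h by (auto simp: strong_entourage_def)
      have "\<bar>f x - h x\<bar> < r + s" if "x \<in> enlargement B (min d e)" for x
      proof -
        have "x \<in> enlargement B d" "x \<in> enlargement B e"
          using that by (auto simp: enlargement_def)
        then have "\<bar>f x - g x\<bar> < r" "\<bar>g x - h x\<bar> < s" using de by auto
        then show ?thesis by linarith
      qed
      moreover have "min d e > 0" using de by simp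
      ultimately have "\<exists>\<delta>>0. \<forall>x\<in>enlargement B \<delta>. \<bar>f x - h x\<bar> < r + s" by blast
      then show ?thesis using r(3) h by (simp add: strong_entourage_def)
    qed
    then have "strong_entourage B s `` {g} \<subseteq> ?U"
      using r s by (auto intro!: exI[of _ "r + s"])
    then show "\<exists>V\<in>strong_entourages \<BB>. V `` {g} \<subseteq> ?U"
      using s assms(2) by (auto simp: strong_entourages_def)
  qed
qed


section \<open>Tightness and supertightness\<close>

text \<open>
  Cardinals are cardinal orders in the sense of \<open>Card_order\<close>, compared by \<open>\<le>o\<close> and \<open>=o\<close>.
  Since HOL has no type of all cardinals, the invariants of a topology on a type \<open>'b\<close> are taken
  as cardinal orders on \<open>nat + 'b set\<close>. This type is infinite and at least as large as every
  subset of \<open>'b\<close> and every family of subsets of \<open>'b\<close>, so the smallest cardinal there is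
  the smallest one among all cardinals; see the lemmas \<open>tightness_le\<close>,
  \<open>supertightness_at_le\<close> and \<open>cardinal_sup_le\<close>, where \<open>m\<close> lives on an arbitrary type.
\<close>

definition least_cardinal :: "('c rel \<Rightarrow> bool) \<Rightarrow> 'c rel" where
  "least_cardinal P =
     (SOME m. Card_order m \<and> P m \<and> (\<forall>m'. Card_order m' \<and> P m' \<longrightarrow> m \<le>o m'))"

definition cardinal_sup :: "'c rel set \<Rightarrow> 'c rel" where
  "cardinal_sup R = least_cardinal (\<lambda>m. \<forall>r\<in>R. r \<le>o m)"

definition tight_within :: "'b topology \<Rightarrow> 'k rel \<Rightarrow> bool" where
  "tight_within Y m \<longleftrightarrow>
     (\<forall>A y. A \<subseteq> topspace Y \<and> y \<in> Y closure_of A \<longrightarrow>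
        (\<exists>B\<subseteq>A. |B| \<le>o m \<and> y \<in> Y closure_of B))"

definition tightness :: "'b topology \<Rightarrow> (nat + 'b set) rel" where
  "tightness Y = least_cardinal (\<lambda>m. cinfinite m \<and> tight_within Y m)"

definition pi_network_at :: "'b topology \<Rightarrow> 'b \<Rightarrow> 'b set set \<Rightarrow> bool" where
  "pi_network_at Y y \<A> \<longleftrightarrow>
     (\<forall>A\<in>\<A>. A \<subseteq> topspace Y) \<and>
     (\<forall>U. openin Y U \<and> y \<in> U \<longrightarrow> (\<exists>A\<in>\<A>. A \<subseteq> U))"

definition supertight_within :: "'b topology \<Rightarrow> 'b \<Rightarrow> 'k rel \<Rightarrow> bool" where
  "supertight_within Y y m \<longleftrightarrow>
     (\<forall>\<A>. pi_network_at Y y \<A> \<and> (\<forall>A\<in>\<A>. finite A) \<longrightarrow>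
        (\<exists>\<A>'\<subseteq>\<A>. |\<A>'| \<le>o m \<and> pi_network_at Y y \<A>'))"

definition supertightness_at :: "'b topology \<Rightarrow> 'b \<Rightarrow> (nat + 'b set) rel" where
  "supertightness_at Y y = least_cardinal (supertight_within Y y)"

definition supertightness :: "'b topology \<Rightarrow> (nat \<times> (nat + 'b set)) rel" where
  "supertightness Y = natLeq *c cardinal_sup (supertightness_at Y ` topspace Y)"

lemma least_cardinal:
  assumes "Card_order m" "P m"
  shows "Card_order (least_cardinal P)" "P (least_cardinal P)"
    "\<And>m'. Card_order m' \<Longrightarrow> P m' \<Longrightarrow> least_cardinal P \<le>o m'"
proof -
  have "\<exists>m\<in>{m. Card_order m \<and> P m}. \<forall>m'\<in>{m. Card_order m \<and> P m}. m \<le>o m'"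
    using assms by (intro exists_minim_Card_order) auto
  then have "\<exists>m. Card_order m \<and> P m \<and> (\<forall>m'. Card_order m' \<and> P m' \<longrightarrow> m \<le>o m')" by blast
  from someI_ex[OF this] show "Card_order (least_cardinal P)" "P (least_cardinal P)"
    "\<And>m'. Card_order m' \<Longrightarrow> P m' \<Longrightarrow> least_cardinal P \<le>o m'"
    unfolding least_cardinal_def by blast+
qed

lemma Card_order_le_UNIV: "Card_order (r :: 'c rel) \<Longrightarrow> r \<le>o |UNIV :: 'c set|"
  by (rule ordIso_ordLeq_trans[OF ordIso_symmetric[OF card_of_Field_ordIso] card_of_mono1])
    auto

text \<open>Minimality among cardinals on one type transfers to cardinals on all types.\<close>

lemma least_cardinal_le:
  fixes P :: "'c rel \<Rightarrow> bool" and m :: "'k rel"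
  assumes "P |UNIV|" "Card_order m" and "\<And>r. Card_order r \<Longrightarrow> r =o m \<Longrightarrow> P r"
  shows "least_cardinal P \<le>o m"
proof (cases "m \<le>o |UNIV :: 'c set|")
  case True
  have "|Field m| \<le>o |UNIV :: 'c set|"
    by (rule ordIso_ordLeq_trans[OF card_of_Field_ordIso[OF assms(2)] True])
  then obtain A :: "'c set" where "|Field m| =o |A|"
    unfolding internalize_card_of_ordLeq[of "Field m"] by (elim exE conjE)
  then have "|A| =o m"
    by (rule ordIso_transitive[OF ordIso_symmetric card_of_Field_ordIso[OF assms(2)]])
  then have "P |A|"
    by (rule assms(3)[OF card_of_Card_order])
  then have "least_cardinal P \<le>o |A|"
    by (rule least_cardinal(3)[where P = P, OF card_of_Card_order assms(1) card_of_Card_order])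
  then show ?thesis
    using \<open>|A| =o m\<close> by (rule ordLeq_ordIso_trans)
next
  case False
  then have "|UNIV :: 'c set| \<le>o m"
    using ordLeq_total[OF card_of_Well_order[of "UNIV :: 'c set"] card_order_on_well_order_on[OF assms(2)]]
    by (elim disjE) simp_all
  then show ?thesis
    by (rule ordLeq_transitive[OF least_cardinal(3)[where P = P,
          OF card_of_Card_order assms(1) card_of_Card_order assms(1)]])
qed

lemma tight_within_UNIV: "tight_within Y |UNIV :: (nat + 'b set) set|"
  for Y :: "'b topology"
proof -
  have "|B| \<le>o |UNIV :: (nat + 'b set) set|" for B :: "'b set"
    by (rule card_of_ordLeqI[of "\<lambda>b. Inr {b}"]) (auto simp: inj_on_def)
  then show ?thesis unfolding tight_within_def by blast
qed

lemma supertight_within_UNIV: "supertight_within Y y |UNIV :: (nat + 'b set) set|"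
  for Y :: "'b topology"
proof -
  have "|\<A>| \<le>o |UNIV :: (nat + 'b set) set|" for \<A> :: "'b set set"
    by (rule card_of_ordLeqI[of Inr]) (auto simp: inj_on_def)
  then show ?thesis unfolding supertight_within_def by blast
qed

lemma cinfinite_UNIV_sum: "cinfinite |UNIV :: (nat + 'c) set|"
  by (simp add: cinfinite_def Field_card_of)

lemma tightness:
  "Card_order (tightness Y)" "cinfinite (tightness Y)" "tight_within Y (tightness Y)"
proof -
  note least = least_cardinal[where P = "\<lambda>m. cinfinite m \<and> tight_within Y m",
      OF card_of_Card_order conjI[OF cinfinite_UNIV_sum tight_within_UNIV], folded tightness_def]
  show "Card_order (tightness Y)" by (rule least(1))
  show "cinfinite (tightness Y)" "tight_within Y (tightness Y)"
    using least(2) by simp_all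
qed

lemma tightness_le:
  assumes "Card_order m" "cinfinite m" "tight_within Y m"
  shows "tightness Y \<le>o m"
  unfolding tightness_def
proof (rule least_cardinal_le)
  fix r assume r: "Card_order r" "r =o m"
  then have "cinfinite r"
    using assms cinfinite_mono ordIso_imp_ordLeq ordIso_symmetric by blast
  moreover have "|B| \<le>o r" if "|B| \<le>o m" for B
    using that r ordIso_symmetric ordLeq_ordIso_trans by blast
  ultimately show "cinfinite r \<and> tight_within Y r"
    using assms(3) unfolding tight_within_def by meson
qed (simp_all add: assms tight_within_UNIV cinfinite_UNIV_sum)

lemma supertightness_at:
  "Card_order (supertightness_at Y y)" "supertight_within Y y (supertightness_at Y y)"
  unfolding supertightness_at_def
  by (rule least_cardinal[where P = "supertight_within Y y",
        OF card_of_Card_order supertight_within_UNIV])+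

lemma supertightness_at_le:
  assumes "Card_order m" "supertight_within Y y m"
  shows "supertightness_at Y y \<le>o m"
  unfolding supertightness_at_def
proof (rule least_cardinal_le)
  fix r assume r: "Card_order r" "r =o m"
  have "|B| \<le>o r" if "|B| \<le>o m" for B
    using that r ordIso_symmetric ordLeq_ordIso_trans by blast
  then show "supertight_within Y y r"
    using assms(2) unfolding supertight_within_def by meson
qed (simp_all add: assms supertight_within_UNIV)

lemma cardinal_sup:
  fixes R :: "'c rel set"
  assumes "\<And>r. r \<in> R \<Longrightarrow> Card_order r"
  shows "Card_order (cardinal_sup R)" "\<And>r. r \<in> R \<Longrightarrow> r \<le>o cardinal_sup R"
proof -
  have *: "\<forall>r\<in>R. r \<le>o |UNIV :: 'c set|" by (intro ballI Card_order_le_UNIV assms)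
  note least = least_cardinal[where P = "\<lambda>m. \<forall>r\<in>R. r \<le>o m",
      OF card_of_Card_order *, folded cardinal_sup_def]
  show "Card_order (cardinal_sup R)" by (rule least(1))
  show "\<And>r. r \<in> R \<Longrightarrow> r \<le>o cardinal_sup R" by (rule bspec[OF least(2)])
qed

lemma cardinal_sup_le:
  assumes "\<And>r. r \<in> R \<Longrightarrow> Card_order r" "Card_order m" "\<And>r. r \<in> R \<Longrightarrow> r \<le>o m"
  shows "cardinal_sup R \<le>o m"
  unfolding cardinal_sup_def
proof (rule least_cardinal_le)
  fix r assume "Card_order r" "r =o m"
  then show "\<forall>x\<in>R. x \<le>o r"
    using assms(3) ordIso_symmetric ordLeq_ordIso_trans by blast
qed (simp_all add: assms Card_order_le_UNIV)

end

(* The inequality t <= st is obtained by applying supertightness to pi-networks of singletons.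
   For the converse, a pi-network of finite sets F at f yields for each n the open sets
   U_F = {x. |g x - f x| < 1/n for all g in F}, and every B in the bornology has an enlargement
   inside one of them.  The continuous functions equal to 1 off some U_F therefore accumulate at 0,
   and tightness at 0 selects few of them, hence few F.  The union over n of these selections is
   a pi-network at f. *)

theory Submission
  imports Defs
begin

section \<open>Closure points and pi-networks in terms of basic entourages\<close>

lemma closure_of_strong_uniform_topology:
  assumes "bornology \<BB>"
  shows "f \<in> strong_uniform_topology \<BB> closure_of A \<longleftrightarrow>
    f \<in> cont_funs \<and> (\<forall>B\<in>\<BB>. \<forall>\<epsilon>>0. \<exists>g\<in>A. (f, g) \<in> strong_entourage B \<epsilon>)"
    (is "?L \<longleftrightarrow> ?R")
proof
  assume L: ?L
  then have f: "f \<in> cont_funs"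
    by (simp add: in_closure_of topspace_strong_uniform_topology[OF assms])
  have "\<exists>g\<in>A. (f, g) \<in> strong_entourage B \<epsilon>" if B: "B \<in> \<BB>" and \<epsilon>: "\<epsilon> > 0" for B \<epsilon>
  proof -
    obtain U where "openin (strong_uniform_topology \<BB>) U" "f \<in> U"
      "U \<subseteq> strong_entourage B \<epsilon> `` {f}"
      using strong_entourage_neighbourhood[OF assms B \<epsilon> f] by blast
    moreover from L this(1,2) obtain g where "g \<in> A" "g \<in> U"
      unfolding in_closure_of by blast
    ultimately show ?thesis by blast
  qed
  with f show ?R by blast
next
  assume R: ?R
  have "\<exists>g\<in>A. g \<in> U" if U: "f \<in> U" "openin (strong_uniform_topology \<BB>) U" for U
  proof -
    obtain B \<epsilon> where "B \<in> \<BB>" "\<epsilon> > 0" "strong_entourage B \<epsilon> `` {f} \<subseteq> U"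
      using U unfolding openin_strong_uniform_topology[OF assms] strong_entourages_def by blast
    with R show ?thesis by blast
  qed
  with R show ?L
    unfolding in_closure_of topspace_strong_uniform_topology[OF assms] by blast
qed

lemma pi_network_at_strong_uniform_topology:
  assumes "bornology \<BB>" "f \<in> cont_funs"
  shows "pi_network_at (strong_uniform_topology \<BB>) f \<A> \<longleftrightarrow>
    (\<forall>A\<in>\<A>. A \<subseteq> cont_funs) \<and>
    (\<forall>B\<in>\<BB>. \<forall>\<epsilon>>0. \<exists>A\<in>\<A>. A \<subseteq> strong_entourage B \<epsilon> `` {f})"
    (is "?L \<longleftrightarrow> ?R")
proof
  assume L: ?L
  have "\<exists>A\<in>\<A>. A \<subseteq> strong_entourage B \<epsilon> `` {f}" if B: "B \<in> \<BB>" and \<epsilon>: "\<epsilon> > 0" for B \<epsilon>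
  proof -
    obtain U where "openin (strong_uniform_topology \<BB>) U" "f \<in> U"
      "U \<subseteq> strong_entourage B \<epsilon> `` {f}"
      using strong_entourage_neighbourhood[OF assms(1) B \<epsilon> assms(2)] by blast
    moreover from L this(1,2) obtain A where "A \<in> \<A>" "A \<subseteq> U"
      unfolding pi_network_at_def by blast
    ultimately show ?thesis by blast
  qed
  with L show ?R
    by (simp add: pi_network_at_def topspace_strong_uniform_topology[OF assms(1)])
next
  assume R: ?R
  have "\<exists>A\<in>\<A>. A \<subseteq> U" if U: "f \<in> U" "openin (strong_uniform_topology \<BB>) U" for U
  proof -
    obtain B \<epsilon> where "B \<in> \<BB>" "\<epsilon> > 0" "strong_entourage B \<epsilon> `` {f} \<subseteq> U"
      using U unfolding openin_strong_uniform_topology[OF assms(1)] strong_entourages_def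
      by blast
    moreover from R this(1,2) obtain A where "A \<in> \<A>" "A \<subseteq> strong_entourage B \<epsilon> `` {f}"
      by blast
    ultimately show ?thesis by blast
  qed
  with R show ?L
    by (simp add: pi_network_at_def topspace_strong_uniform_topology[OF assms(1)])
qed

section \<open>From tightness to a covering property of enlargements\<close>

text \<open>Urysohn-type function obtained by truncating a rescaled distance to \<open>B\<close>.
  Vanishing on a whole enlargement, not merely on \<open>B\<close>, is what makes it close to 0 in
  the strong sense.\<close>

lemma enlargement_separation:
  fixes B :: "'a::metric_space set"
  assumes "\<delta> > 0" "enlargement B \<delta> \<subseteq> U"
  shows "\<exists>g\<in>cont_funs. (\<forall>x\<in>enlargement B (\<delta> / 2). g x = 0) \<and> (\<forall>x. x \<notin> U \<longrightarrow> g x = (1::real))"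
proof (cases "B = {}")
  \<comment> \<open>\<open>infdist x {}\<close> is 0 by convention, so the formula below would give
    the zero function; the constant 1 works because the enlargement is empty.\<close>
  case True
  then show ?thesis
    by (intro bexI[of _ "\<lambda>_. 1"]) (auto simp: enlargement_def cont_funs_def)
next
  case False
  \<comment> \<open>The affine expression is 0 at distance \<open>\<delta> / 2\<close> and 1 at
    distance \<open>\<delta>\<close>.\<close>
  define g where "g x = max 0 (min 1 (2 * infdist x B / \<delta> - 1))" for x
  have "g \<in> cont_funs"
    unfolding cont_funs_def g_def using assms(1) by (auto intro!: continuous_intros)
  moreover have "g x = 0" if "x \<in> enlargement B (\<delta> / 2)" for x
  proof -
    from that obtain b where b: "b \<in> B" "dist x b < \<delta> / 2"
      by (auto simp: enlargement_def dist_commute)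
    then have "infdist x B < \<delta> / 2"
      using infdist_le[OF b(1), of x] by linarith
    then show ?thesis using assms(1) by (simp add: g_def field_simps)
  qed
  moreover have "g x = 1" if "x \<notin> U" for x
  proof -
    have "\<delta> \<le> dist x b" if "b \<in> B" for b
      using assms(2) \<open>x \<notin> U\<close> that by (force simp: enlargement_def dist_commute)
    then have "\<delta> \<le> infdist x B"
      using False by (auto simp: infdist_def intro!: cINF_greatest)
    then show ?thesis using assms(1) by (simp add: g_def field_simps)
  qed
  ultimately show ?thesis by blast
qed

text \<open>Finiteness is essential: each \<open>g\<close> in \<open>F\<close> comes with its own
  radius, and finitely many positive radii have a positive minimum. This trades a condition on
  functions for one on subsets of the space.\<close>

lemma finite_subset_strong_entourage_iff:
  assumes "finite F" "F \<subseteq> cont_funs" "f \<in> cont_funs"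
  shows "F \<subseteq> strong_entourage B \<epsilon> `` {f} \<longleftrightarrow>
    (\<exists>\<delta>>0. enlargement B \<delta> \<subseteq> {x. \<forall>g\<in>F. \<bar>f x - g x\<bar> < \<epsilon>})"
    (is "?L \<longleftrightarrow> ?R")
proof
  show "?R" if ?L
    using assms(1) that
  proof (induction F)
    case empty
    then show ?case by (auto intro: zero_less_one)
  next
    case (insert g F)
    then obtain d where "d > 0" "enlargement B d \<subseteq> {x. \<forall>g\<in>F. \<bar>f x - g x\<bar> < \<epsilon>}"
      by auto
    moreover from insert.prems obtain e
      where "e > 0" "enlargement B e \<subseteq> {x. \<bar>f x - g x\<bar> < \<epsilon>}"
      by (auto simp: strong_entourage_def)
    moreover have "enlargement B (min d e) \<subseteq> enlargement B d \<inter> enlargement B e"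
      by (simp add: enlargement_mono)
    ultimately show ?case by (intro exI[of _ "min d e"]) auto
  qed
  show ?L if ?R
    using that assms(2,3) unfolding strong_entourage_def by blast
qed

text \<open>Tightness at the zero function, read as a Lindelof-type selection principle. Sets
  \<open>U i\<close> are encoded by functions equal to 1 off them, and a function near 0 reveals an
  enlargement inside its \<open>U i\<close>.\<close>

lemma tight_within_strong_uniform_topology_enlargement_cover:
  fixes \<BB> :: "'a::metric_space set set"
  assumes "bornology \<BB>" "tight_within (strong_uniform_topology \<BB>) m"
    and cover: "\<And>B. B \<in> \<BB> \<Longrightarrow> \<exists>i\<in>I. \<exists>\<delta>>0. enlargement B \<delta> \<subseteq> U i"
  shows "\<exists>J\<subseteq>I. |J| \<le>o m \<and> (\<forall>B\<in>\<BB>. \<exists>j\<in>J. \<exists>\<delta>>0. enlargement B \<delta> \<subseteq> U j)"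
proof -
  define A where "A = {g \<in> cont_funs. \<exists>i\<in>I. \<forall>x. x \<notin> U i \<longrightarrow> g x = (1::real)}"
  have zero: "(\<lambda>_. 0) \<in> cont_funs" by (simp add: cont_funs_def)
  have "(\<lambda>_. 0) \<in> strong_uniform_topology \<BB> closure_of A"
    unfolding closure_of_strong_uniform_topology[OF assms(1)]
  proof (intro conjI ballI allI impI zero)
    fix B and \<epsilon> :: real assume B: "B \<in> \<BB>" and "\<epsilon> > 0"
    obtain i \<delta> where i: "i \<in> I" and \<delta>: "\<delta> > 0" "enlargement B \<delta> \<subseteq> U i"
      using cover[OF B] by blast
    obtain g where g: "g \<in> cont_funs" "\<forall>x\<in>enlargement B (\<delta> / 2). g x = 0"
      "\<forall>x. x \<notin> U i \<longrightarrow> g x = 1"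
      using enlargement_separation[OF \<delta>] by blast
    have "((\<lambda>_. 0), g) \<in> strong_entourage B \<epsilon>"
      using zero g(1,2) \<open>\<epsilon> > 0\<close> \<delta>(1)
      by (auto simp: strong_entourage_def intro!: exI[of _ "\<delta> / 2"])
    moreover have "g \<in> A" using g i by (auto simp: A_def)
    ultimately show "\<exists>g\<in>A. ((\<lambda>_. 0), g) \<in> strong_entourage B \<epsilon>" by blast
  qed
  moreover have "A \<subseteq> topspace (strong_uniform_topology \<BB>)"
    by (auto simp: A_def topspace_strong_uniform_topology[OF assms(1)])
  ultimately obtain A' where A': "A' \<subseteq> A" "|A'| \<le>o m"
    "(\<lambda>_. 0) \<in> strong_uniform_topology \<BB> closure_of A'"
    using assms(2) unfolding tight_within_def by blast
  have "\<forall>g\<in>A'. \<exists>i\<in>I. \<forall>x. x \<notin> U i \<longrightarrow> g x = 1"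
    using A'(1) by (auto simp: A_def)
  then obtain c where c: "\<forall>g\<in>A'. c g \<in> I \<and> (\<forall>x. x \<notin> U (c g) \<longrightarrow> g x = 1)"
    by metis
  have "\<exists>j\<in>c ` A'. \<exists>\<delta>>0. enlargement B \<delta> \<subseteq> U j" if "B \<in> \<BB>" for B
  proof -
    \<comment> \<open>Tolerance 1 matches the value of \<open>g\<close> off \<open>U (c g)\<close>:
      where \<open>g\<close> stays below 1 in absolute value, the point must lie in
      \<open>U (c g)\<close>.\<close>
    obtain g where g: "g \<in> A'" "((\<lambda>_. 0), g) \<in> strong_entourage B 1"
      using A'(3) \<open>B \<in> \<BB>\<close> unfolding closure_of_strong_uniform_topology[OF assms(1)]
      by (meson zero_less_one)
    then obtain \<delta> where "\<delta> > 0" and small: "\<forall>x\<in>enlargement B \<delta>. \<bar>g x\<bar> < 1"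
      by (auto simp: strong_entourage_def)
    moreover have "enlargement B \<delta> \<subseteq> U (c g)"
    proof
      fix x assume "x \<in> enlargement B \<delta>"
      with small have "g x \<noteq> 1" by force
      then show "x \<in> U (c g)" using c g(1) by blast
    qed
    ultimately show ?thesis using g(1) by blast
  qed
  moreover have "|c ` A'| \<le>o m"
    using card_of_image A'(2) by (rule ordLeq_transitive)
  ultimately show ?thesis
    using c by (intro exI[of _ "c ` A'"]) auto
qed

text \<open>Tightness is applied only at 0, although \<open>f\<close> is arbitrary: the differences
  \<open>f x - g x\<close> in the sets \<open>U n F\<close> absorb the translation.\<close>

lemma supertight_within_strong_uniform_topology:
  fixes \<BB> :: "'a::metric_space set set"
  assumes born: "bornology \<BB>" and f: "f \<in> cont_funs"
    and m: "Card_order m" "cinfinite m" "tight_within (strong_uniform_topology \<BB>) m"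
  shows "supertight_within (strong_uniform_topology \<BB>) f m"
  unfolding supertight_within_def
proof (intro allI impI)
  fix \<A> assume "pi_network_at (strong_uniform_topology \<BB>) f \<A> \<and> (\<forall>A\<in>\<A>. finite A)"
  then have fin: "\<And>F. F \<in> \<A> \<Longrightarrow> finite F" and sub: "\<And>F. F \<in> \<A> \<Longrightarrow> F \<subseteq> cont_funs"
    and net: "\<And>B \<epsilon>. B \<in> \<BB> \<Longrightarrow> \<epsilon> > 0 \<Longrightarrow> \<exists>F\<in>\<A>. F \<subseteq> strong_entourage B \<epsilon> `` {f}"
    unfolding pi_network_at_strong_uniform_topology[OF born f] by blast+
  define U where "U n F = {x. \<forall>g\<in>F. \<bar>f x - g x\<bar> < 1 / real (Suc n)}" for n F
  have U: "F \<subseteq> strong_entourage B (1 / real (Suc n)) `` {f} \<longleftrightarrow>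
      (\<exists>\<delta>>0. enlargement B \<delta> \<subseteq> U n F)" if "F \<in> \<A>" for F B n
    unfolding U_def by (rule finite_subset_strong_entourage_iff[OF fin[OF that] sub[OF that] f])
  have "\<exists>J\<subseteq>\<A>. |J| \<le>o m \<and> (\<forall>B\<in>\<BB>. \<exists>F\<in>J. \<exists>\<delta>>0. enlargement B \<delta> \<subseteq> U n F)" for n
  proof (rule tight_within_strong_uniform_topology_enlargement_cover[OF born m(3)])
    fix B assume "B \<in> \<BB>"
    then obtain F where "F \<in> \<A>" "F \<subseteq> strong_entourage B (1 / real (Suc n)) `` {f}"
      using net[of B "1 / real (Suc n)"] by auto
    then show "\<exists>F\<in>\<A>. \<exists>\<delta>>0. enlargement B \<delta> \<subseteq> U n F"
      using U by blast
  qed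
  then obtain J where J: "\<And>n. J n \<subseteq> \<A>" "\<And>n. |J n| \<le>o m"
    "\<And>n B. B \<in> \<BB> \<Longrightarrow> \<exists>F\<in>J n. \<exists>\<delta>>0. enlargement B \<delta> \<subseteq> U n F"
    by metis
  \<comment> \<open>Countably many families of size at most \<open>m\<close> have a union of size at
    most \<open>m\<close>, as \<open>m\<close> is infinite.\<close>
  have "|\<Union>n. J n| \<le>o m"
  proof (rule card_of_UNION_ordLeq_infinite_Field)
    show "infinite (Field m)" using m(2) by (simp add: cinfinite_def)
    show "|UNIV :: nat set| \<le>o m"
      using ordIso_ordLeq_trans[OF card_of_nat natLeq_ordLeq_cinfinite] m(1,2) by blast
  qed (use m J in auto)
  moreover have "pi_network_at (strong_uniform_topology \<BB>) f (\<Union>n. J n)"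
    unfolding pi_network_at_strong_uniform_topology[OF born f]
  proof (intro conjI ballI allI impI)
    show "F \<subseteq> cont_funs" if "F \<in> (\<Union>n. J n)" for F
      using that J(1) sub by blast
    fix B and \<epsilon> :: real assume B: "B \<in> \<BB>" and "\<epsilon> > 0"
    then obtain n where n: "1 / real (Suc n) < \<epsilon>"
      using nat_approx_posE by blast
    obtain F where F: "F \<in> J n" "\<exists>\<delta>>0. enlargement B \<delta> \<subseteq> U n F"
      using J(3)[OF B] by blast
    then have "F \<subseteq> strong_entourage B (1 / real (Suc n)) `` {f}"
      using U J(1) by blast
    also have "\<dots> \<subseteq> strong_entourage B \<epsilon> `` {f}"
      by (intro Image_mono strong_entourage_mono order_refl less_imp_le n)
    finally show "\<exists>F\<in>(\<Union>n. J n). F \<subseteq> strong_entourage B \<epsilon> `` {f}"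
      using F(1) by blast
  qed
  ultimately show "\<exists>\<A>'\<subseteq>\<A>. |\<A>'| \<le>o m \<and> pi_network_at (strong_uniform_topology \<BB>) f \<A>'"
    using J(1) by (intro exI[of _ "\<Union>n. J n"]) auto
qed

section \<open>Comparison of the two invariants in a general space\<close>

text \<open>For points of the space, the singletons of \<open>A\<close> form a pi-network at
  \<open>y\<close> exactly when \<open>y\<close> is in the closure of \<open>A\<close>, and
  subfamilies of them correspond to subsets of \<open>A\<close>.\<close>

lemma tight_within_if_supertight_within:
  assumes "\<And>y. y \<in> topspace Y \<Longrightarrow> supertight_within Y y m"
  shows "tight_within Y m"
  unfolding tight_within_def
proof (intro allI impI)
  fix A y assume A: "A \<subseteq> topspace Y \<and> y \<in> Y closure_of A"
  then have y: "y \<in> topspace Y" by (simp add: in_closure_of)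
  have "pi_network_at Y y ((\<lambda>a. {a}) ` A)"
    using A by (auto simp: pi_network_at_def in_closure_of)
  then obtain \<A> where \<A>: "\<A> \<subseteq> (\<lambda>a. {a}) ` A" "|\<A>| \<le>o m" "pi_network_at Y y \<A>"
    using assms[OF y] unfolding supertight_within_def by blast
  then obtain B where B: "B \<subseteq> A" "\<A> = (\<lambda>a. {a}) ` B"
    by (auto simp: subset_image_iff)
  have "|B| \<le>o |\<A>|"
    by (rule card_of_ordLeqI[of "\<lambda>a. {a}"]) (auto simp: B(2))
  then have "|B| \<le>o m" using \<A>(2) by (rule ordLeq_transitive)
  moreover have "y \<in> Y closure_of B"
    using \<A>(3) y by (auto simp: pi_network_at_def B(2) in_closure_of)
  ultimately show "\<exists>B\<subseteq>A. |B| \<le>o m \<and> y \<in> Y closure_of B"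
    using B(1) by blast
qed

lemma supertight_within_mono:
  assumes "supertight_within Y y m" "m \<le>o k"
  shows "supertight_within Y y k"
  using assms ordLeq_transitive unfolding supertight_within_def by meson

text \<open>A zero bound would allow only the empty subfamily, which is not a pi-network because the
  whole space is a neighbourhood of \<open>y\<close>. This keeps the product with
  \<open>natLeq\<close> infinite.\<close>

lemma supertight_within_nonzero:
  assumes "y \<in> topspace Y" "Card_order m" "supertight_within Y y m"
  shows "Field m \<noteq> {}"
proof
  assume "Field m = {}"
  have "pi_network_at Y y {{y}}"
    using assms(1) by (auto simp: pi_network_at_def)
  then obtain \<A> where \<A>: "|\<A>| \<le>o m" "pi_network_at Y y \<A>"
    using assms(3) unfolding supertight_within_def by blast
  from \<A>(1) have "|\<A>| \<le>o |Field m|"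
    using card_of_Field_ordIso[OF assms(2)] ordIso_symmetric ordLeq_ordIso_trans by blast
  then have "\<A> = {}"
    using \<open>Field m = {}\<close> card_of_empty3 by metis
  then show False
    using \<A>(2) assms(1) unfolding pi_network_at_def by blast
qed

text \<open>Nonemptiness matters: over an empty space the supremum, hence the product, is 0, while
  the tightness is infinite by definition.\<close>

lemma tightness_le_supertightness:
  fixes Y :: "'b topology"
  assumes "topspace Y \<noteq> {}"
  shows "tightness Y \<le>o supertightness Y"
proof -
  let ?s = "cardinal_sup (supertightness_at Y ` topspace Y)"
  have s: "Card_order ?s" and st: "\<And>y. y \<in> topspace Y \<Longrightarrow> supertightness_at Y y \<le>o ?s"
    by (rule cardinal_sup(1), force simp: supertightness_at(1))
      (rule cardinal_sup(2), auto simp: supertightness_at(1))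
  have within: "supertight_within Y y ?s" if "y \<in> topspace Y" for y
    by (rule supertight_within_mono[OF supertightness_at(2) st[OF that]])
  have "Field ?s \<noteq> {}"
    using supertight_within_nonzero[OF _ s within] assms by blast
  then have inf: "cinfinite (supertightness Y)"
    by (simp add: supertightness_def cinfinite_def cprod_def Field_card_of finite_cartesian_product_iff
        Field_natLeq)
  have "?s \<le>o supertightness Y"
    unfolding supertightness_def by (rule ordLeq_cprod2[OF Cinfinite_Cnotzero[OF natLeq_Cinfinite] s])
  then have "tight_within Y (supertightness Y)"
    by (intro tight_within_if_supertight_within supertight_within_mono[OF within])
  then show ?thesis
    using inf by (intro tightness_le) (auto simp: supertightness_def Card_order_cprod)
qed

theorem theorem3p2:
  fixes \<BB> :: "'a::metric_space set set"
  assumes "infinite (UNIV :: 'a set)"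
    and "bornology \<BB>"
    and "has_closed_base \<BB>"
    and "UNIV \<notin> \<BB>"
  shows "supertightness (strong_uniform_topology \<BB>) =o tightness (strong_uniform_topology \<BB>)"
proof -
  let ?Y = "strong_uniform_topology \<BB>"
  note top = topspace_strong_uniform_topology[OF assms(2)]
  note t = tightness[of ?Y]
  have "(\<lambda>_. 0) \<in> topspace ?Y"
    by (simp add: top cont_funs_def)
  then have "tightness ?Y \<le>o supertightness ?Y"
    by (intro tightness_le_supertightness) blast
  \<comment> \<open>An infinite cardinal bounds a product once it bounds both factors, here
    \<open>natLeq\<close> and the supremum of the local supertightness.\<close>
  moreover have "supertightness ?Y \<le>o tightness ?Y"
    unfolding supertightness_def
  proof (rule cprod_cinfinite_bound)
    show "natLeq \<le>o tightness ?Y"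
      using t natLeq_ordLeq_cinfinite by blast
    show "cardinal_sup (supertightness_at ?Y ` topspace ?Y) \<le>o tightness ?Y"
      using supertightness_at(1) t
      by (intro cardinal_sup_le)
        (auto simp: top intro!: supertightness_at_le supertight_within_strong_uniform_topology assms)
    show "Card_order (cardinal_sup (supertightness_at ?Y ` topspace ?Y))"
      by (rule cardinal_sup(1)) (auto simp: supertightness_at(1))
  qed (use t natLeq_Card_order in auto)
  ultimately show ?thesis by (simp add: ordIso_iff_ordLeq)
qed

end
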